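(* Assume that there exist constants $C,\lambda>0$ and $\zeta\in(0,1]$, $\sigma_\epsilon$-invariant measurable sets $\Omega_\epsilon\subset\Omega$, $\epsilon\in I$, with $\mathbb P_\epsilon(\Omega_\epsilon)=1$, and for each $\epsilon\in I$ a family $(h_{\omega,\epsilon})_{\omega\in\Omega_\epsilon}\subset\mathcal B_s$ such that: (1) for all $h\in\mathcal B_w$ with $\psi(h)=0$, $n\in\mathbb N$, $\epsilon\in I$ and $\omega\in\Omega_\epsilon$, $$\|\mathcal L_{\omega,\epsilon}^n h\|_w\le Ce^{-\lambda n}\|h\|_w;$$ (2) for all $\epsilon\in I$, $h\in\mathcal B_s$, $\omega\in\Omega_\epsilon$ and $\omega'\in\Omega_0$, $$\|\mathcal L_{\omega,\epsilon}h-\mathcal L_{\omega'}h\|_w\le C\left(d(\omega,\omega')^\zeta+|\epsilon|^\zeta\right)\|h\|_s;$$ (3) $\psi(h_{\omega,\epsilon})=1$ and $\|h_{\omega,\epsilon}\|_s\le C$ for all $\epsilon\in I$ and $\omega\in\Omega_\epsilon$; (4) $\mathcal L_{\omega,\epsilon}h_{\omega,\epsilon}=h_{\sigma_\epsilon\omega,\epsilon}$ for all $\epsilon\in I$ and $\omega\in\Omega_\epsilon$; (5) $\sigma^{-1}$ is Lipschitz continuous. Let $c=\ln(\mathrm{Lip}(\sigma^{-1}))$, and let $\alpha\in(0,1]$ satisfy $c\alpha\zeta<\lambda$. Then there exists $D>0$ such that for every $\epsilon\in I$ and every $\omega\in\Omega_\epsilon\cap\Omega_0$, $$\|h_{\omega,\epsilon}-h_\omega\|_w\le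 D\left(|\epsilon|^\zeta+\left(\mathrm{dist}_{C^0}(\sigma^{-1},\sigma_\epsilon^{-1})\right)^{\alpha\zeta}\right),$$ where $h_\omega:=h_{\omega,0}$.
   Context: $\Omega$ is a bounded metric space with metric $d$, and $I\subset\mathbb R$ is a set containing $0$, with $0$ an accumulation point of $I$. For each $\epsilon\in I$, $\sigma_\epsilon:\Omega\to\Omega$ is a homeomorphism and $\mathbb P_\epsilon$ is a $\sigma_\epsilon$-invariant Borel probability measure on $\Omega$. The map $(\omega,\epsilon)\mapsto\sigma_\epsilon\omega$ is continuous. Write $\sigma=\sigma_0$. $(\mathcal B_w,\|\cdot\|_w)$ and $(\mathcal B_s,\|\cdot\|_s)$ are Banach spaces such that $\mathcal B_s$ is embedded in $\mathcal B_w$ and $\|\cdot\|_w\le\|\cdot\|_s$ on $\mathcal B_s$. $\psi$ is a non-zero bounded linear functional on $\mathcal B_s$ admitting a bounded extension to $\mathcal B_w$ (still denoted $\psi$). For each $\omega\in\Omega$, $\epsilon\in I$, $\mathcal L_{\omega,\epsilon}$ is a bounded linear operator on both $\mathcal B_s$ and $\mathcal B_w$, and $\psi(\mathcal L_{\omega,\epsilon}h)=\psi(h)$ for all $\epsilon\in I$, $\omega\in\Omega$, $h\in\mathcal B_w$. For $n\in\mathbb N$, $$\mathcal L_{\omega,\epsilon}^n:=\mathcal L_{\sigma_\epsilon^{n-1}\omega,\epsilon}\circ\cdots\circ\mathcal L_{\sigma_\epsilon\omega,\epsilon}\circ\mathcal L_{\omega,\epsilon},$$ and $\mathcal L_\omega:=\mathcal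 L_{\omega,0}$. $\mathrm{Lip}(\cdot)$ denotes the Lipschitz constant, and $\mathrm{dist}_{C^0}(\sigma^{-1},\sigma_\epsilon^{-1}):=\sup_{y\in\Omega}d(\sigma^{-1}(y),\sigma_\epsilon^{-1}(y))$. *)

theory Defs
  imports "HOL-Probability.Probability"
begin

definition Lip :: "('a::metric_space \<Rightarrow> 'b::metric_space) \<Rightarrow> real" where
  "Lip f = Inf {K. K-lipschitz_on UNIV f}"

text \<open>
  A Lipschitz surjection \<open>f\<close> of a bounded space onto itself has \<open>Lip f < 1\<close> only if the space is a point.
  Then \<open>Lip f = 0\<close>, and \<open>ln 0 = 0\<close> stands in for minus infinity.
\<close>

definition dist_C0 :: "('a \<Rightarrow> 'b::metric_space) \<Rightarrow> ('a \<Rightarrow> 'b) \<Rightarrow> real" where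
  "dist_C0 f g = (SUP y. dist (f y) (g y))"

primrec cocycle :: "('o \<Rightarrow> 'o) \<Rightarrow> ('o \<Rightarrow> 'w \<Rightarrow> 'w) \<Rightarrow> 'o \<Rightarrow> nat \<Rightarrow> 'w \<Rightarrow> 'w" where
  "cocycle \<tau> L \<omega> 0 = id"
| "cocycle \<tau> L \<omega> (Suc n) = L ((\<tau> ^^ n) \<omega>) \<circ> cocycle \<tau> L \<omega> n"

text \<open>
  The space \<open>\<Omega>\<close> is the type \<open>'o\<close>, the weak space is the type \<open>'w\<close>, and the strong space is the
  type \<open>'s\<close>, embedded in \<open>'w\<close> by \<open>J\<close>. An operator acting on both spaces is an operator \<open>L \<omega> \<epsilon>\<close> on
  \<open>'w\<close> whose restriction along \<open>J\<close> is a bounded operator on \<open>'s\<close>. Likewise \<open>\<psi>\<close> is the functional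
  on \<open>'w\<close>, and \<open>\<psi> \<circ> J\<close> the one on \<open>'s\<close>.

  The type \<open>'k\<close> of values of \<open>\<psi>\<close> is the scalar field, \<open>real\<close> or \<open>complex\<close>. For \<open>complex\<close>, the
  Banach spaces are viewed as real ones, and \<open>bounded_linear\<close> asks only for real linearity.
\<close>

locale perturbed_operator_cocycle =
  fixes I :: "real set"
    and \<sigma> :: "real \<Rightarrow> 'o::metric_space \<Rightarrow> 'o"
    and P :: "real \<Rightarrow> 'o measure"
    and J :: "'s::banach \<Rightarrow> 'w::banach"
    and \<psi> :: "'w \<Rightarrow> 'k::real_normed_field"
    and L :: "'o \<Rightarrow> real \<Rightarrow> 'w \<Rightarrow> 'w"
  assumes bounded_space: "bounded (UNIV :: 'o set)"
    and zero_in_I: "0 \<in> I"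
    and zero_islimpt_I: "0 islimpt I"
    and homeomorphism_\<sigma>: "\<epsilon> \<in> I \<Longrightarrow> homeomorphism UNIV UNIV (\<sigma> \<epsilon>) (inv (\<sigma> \<epsilon>))"
    and continuous_\<sigma>: "continuous_on (UNIV \<times> I) (\<lambda>(\<omega>, \<epsilon>). \<sigma> \<epsilon> \<omega>)"
    and prob_space_P: "\<epsilon> \<in> I \<Longrightarrow> prob_space (P \<epsilon>)"
    and sets_P: "\<epsilon> \<in> I \<Longrightarrow> sets (P \<epsilon>) = sets borel"
    and invariant_P: "\<epsilon> \<in> I \<Longrightarrow> distr (P \<epsilon>) borel (\<sigma> \<epsilon>) = P \<epsilon>"
    and linear_J: "linear J"
    and inj_J: "inj J"
    and norm_J_le: "norm (J h) \<le> norm h"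
    and bounded_linear_\<psi>: "bounded_linear \<psi>"
    and \<psi>_nonzero: "\<exists>h. \<psi> (J h) \<noteq> 0"
    and bounded_linear_L: "\<epsilon> \<in> I \<Longrightarrow> bounded_linear (L \<omega> \<epsilon>)"
    and bounded_linear_L_strong:
      "\<epsilon> \<in> I \<Longrightarrow> \<exists>L\<^sub>s. bounded_linear L\<^sub>s \<and> (\<forall>h. J (L\<^sub>s h) = L \<omega> \<epsilon> (J h))"
    and \<psi>_L: "\<epsilon> \<in> I \<Longrightarrow> \<psi> (L \<omega> \<epsilon> f) = \<psi> f"

end

theory Submission
  imports Defs
begin

text \<open>
  Follow the two backward orbits \<open>x j\<close> and \<open>y j\<close> of \<open>\<omega>\<close> under \<open>\<sigma> \<epsilon>\<close> and \<open>\<sigma> 0\<close>. By equivariance, the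
  difference of the two families along them satisfies \<open>a j = b j + L (y (j + 1)) 0 (a (j + 1))\<close>,
  where \<open>b j\<close> is the difference of two operators applied to an element of the strong space and
  \<open>\<psi> (b j) = 0\<close>. Iterating this and using decay on the kernel of \<open>\<psi>\<close>, \<open>a 0\<close> is bounded by the sum of
  \<open>exp (- lam * j) * norm (b j)\<close>. The orbits separate at most like \<open>dist_C0 * M ^ j\<close>, where \<open>M > 1\<close>
  is a Lipschitz constant of the inverse of \<open>\<sigma> 0\<close> with \<open>M powr (\<alpha> * \<zeta>) < exp lam\<close>, so the sum is
  dominated by a convergent geometric series.
\<close>

text \<open>The recursion adds the operator applied last. Extending a backward orbit changes the
  starting point instead, so the operator applied first has to be split off.\<close>

lemma cocycle_Suc_right: "cocycle \<tau> L \<omega> (Suc n) = cocycle \<tau> L (\<tau> \<omega>) n \<circ> L \<omega>"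
proof (induction n)
  case (Suc n)
  have "cocycle \<tau> L \<omega> (Suc (Suc n)) = L ((\<tau> ^^ n) (\<tau> \<omega>)) \<circ> cocycle \<tau> L \<omega> (Suc n)"
    by (simp add: funpow_swap1)
  also have "\<dots> = cocycle \<tau> L (\<tau> \<omega>) (Suc n) \<circ> L \<omega>"
    unfolding Suc.IH by (simp add: o_assoc)
  finally show ?case .
qed simp

lemma linear_cocycle:
  assumes "\<And>x. linear (L x)"
  shows "linear (cocycle \<tau> L \<omega> n)"
proof (induction n)
  case 0
  show ?case by (rule linearI) simp_all
next
  case (Suc n)
  then show ?case unfolding cocycle.simps by (rule linear_compose) (rule assms)
qed

text \<open>Here \<open>p\<close> is a backward orbit. Expanding \<open>a n\<close> in the remainder
  splits off one more summand, and the leftover operator becomes the first factor of the cocycle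
  started one step further back.\<close>

lemma cocycle_telescope:
  assumes lin: "\<And>x. linear (L x)"
    and p: "\<And>j. \<tau> (p (Suc j)) = p j"
    and a: "\<And>j. a j = b j + L (p (Suc j)) (a (Suc j))"
  shows "a 0 = (\<Sum>j<n. cocycle \<tau> L (p j) j (b j)) + cocycle \<tau> L (p n) n (a n)"
proof (induction n)
  case (Suc n)
  have "cocycle \<tau> L (p n) n (a n)
      = cocycle \<tau> L (p n) n (b n) + cocycle \<tau> L (p n) n (L (p (Suc n)) (a (Suc n)))"
    by (subst a) (rule linear_add[OF linear_cocycle[OF lin]])
  also have "cocycle \<tau> L (p n) n (L (p (Suc n)) (a (Suc n)))
      = cocycle \<tau> L (p (Suc n)) (Suc n) (a (Suc n))"
    unfolding cocycle_Suc_right by (simp add: p)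
  finally show ?case using Suc by (simp add: add.assoc del: cocycle.simps)
qed simp

text \<open>Attainment of the infimum is avoided: some Lipschitz constant lies below any strictly
  larger \<open>M\<close>.\<close>

lemma lipschitz_on_of_Lip_less:
  assumes "\<exists>K. K-lipschitz_on UNIV f" and "Lip f < M"
  shows "M-lipschitz_on UNIV f"
proof -
  obtain K where "K-lipschitz_on UNIV f" "K < M"
    using assms cInf_lessD[of "{K. K-lipschitz_on UNIV f}" M] unfolding Lip_def by blast
  then show ?thesis by (meson lipschitz_on_le less_imp_le)
qed

lemma dist_le_dist_C0:
  fixes f g :: "'a \<Rightarrow> 'b::metric_space"
  assumes "bounded (UNIV :: 'b set)"
  shows "dist (f y) (g y) \<le> dist_C0 f g"
proof -
  obtain B where "\<And>u v :: 'b. dist u v \<le> B"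
    using assms unfolding bounded_two_points by blast
  then have "bdd_above (range (\<lambda>y. dist (f y) (g y)))" by (intro bdd_aboveI2)
  then show ?thesis unfolding dist_C0_def by (rule cSUP_upper[OF UNIV_I])
qed

text \<open>One step turns a separation \<open>d\<close> into at most
  \<open>M * d + \<delta>\<close>. Solving this recursion from \<open>0\<close> gives
  \<open>\<delta> * (M ^ n - 1) / (M - 1)\<close>; the induction runs on the form without
  division.\<close>

lemma dist_funpow_le:
  fixes f g :: "'a::metric_space \<Rightarrow> 'a"
  assumes lip: "M-lipschitz_on UNIV f" and M: "M > 1"
    and close: "\<And>y. dist (f y) (g y) \<le> \<delta>"
  shows "dist ((f ^^ n) x) ((g ^^ n) x) \<le> \<delta> * M ^ n / (M - 1)"
proof -
  have \<delta>: "\<delta> \<ge> 0" using close zero_le_dist order_trans by blast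
  have "(M - 1) * dist ((f ^^ n) x) ((g ^^ n) x) \<le> \<delta> * (M ^ n - 1)"
  proof (induction n)
    case (Suc n)
    let ?u = "(f ^^ n) x" and ?v = "(g ^^ n) x"
    have "dist (f ?u) (g ?v) \<le> dist (f ?u) (f ?v) + dist (f ?v) (g ?v)" by (rule dist_triangle)
    also have "\<dots> \<le> M * dist ?u ?v + \<delta>"
      using lipschitz_onD[OF lip] close by (intro add_mono) auto
    finally have "(M - 1) * dist (f ?u) (g ?v) \<le> (M - 1) * (M * dist ?u ?v + \<delta>)"
      using M by (intro mult_left_mono) auto
    also have "\<dots> = M * ((M - 1) * dist ?u ?v) + (M - 1) * \<delta>" by (simp add: algebra_simps)
    also have "\<dots> \<le> M * (\<delta> * (M ^ n - 1)) + (M - 1) * \<delta>"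
      using M Suc by (intro add_right_mono mult_left_mono) auto
    also have "\<dots> = \<delta> * (M ^ Suc n - 1)" by (simp add: algebra_simps)
    finally show ?case by simp
  qed simp
  also have "\<dots> \<le> \<delta> * M ^ n" using \<delta> by (intro mult_left_mono) auto
  finally show ?thesis using M by (simp add: pos_le_divide_eq mult.commute)
qed

text \<open>The surplus exponent \<open>(1 - \<alpha>) * \<zeta>\<close> lies between 0 and 1, so
  that power of \<open>d\<close> is at most \<open>B\<close> because \<open>B\<close> is at least
  1.\<close>

lemma powr_le_mult_powr:
  fixes d B \<alpha> \<zeta> :: real
  assumes "0 \<le> d" "d \<le> B" "1 \<le> B" "0 < \<zeta>" "\<zeta> \<le> 1" "0 < \<alpha>" "\<alpha> \<le> 1"
  shows "d powr \<zeta> \<le> B * d powr (\<alpha> * \<zeta>)"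
proof -
  have e: "0 \<le> (1 - \<alpha>) * \<zeta>" "(1 - \<alpha>) * \<zeta> \<le> 1"
    using assms by (auto intro: mult_le_one)
  have "d powr \<zeta> = d powr ((1 - \<alpha>) * \<zeta>) * d powr (\<alpha> * \<zeta>)"
    by (simp add: powr_add[symmetric] algebra_simps)
  also have "d powr ((1 - \<alpha>) * \<zeta>) \<le> B powr ((1 - \<alpha>) * \<zeta>)"
    using assms e by (intro powr_mono2)
  also have "\<dots> \<le> B powr 1" using assms e by (intro powr_mono) auto
  finally show ?thesis using assms by (simp add: mult_right_mono)
qed

lemma sum_power_le:
  fixes r :: real
  assumes "0 \<le> r" "r < 1"
  shows "(\<Sum>j<n. r ^ j) \<le> 1 / (1 - r)"
proof -
  have "(\<Sum>j<n. r ^ j) \<le> (\<Sum>j. r ^ j)"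
    using assms by (intro sum_le_suminf summable_geometric) auto
  then show ?thesis using assms by (simp add: suminf_geometric)
qed

theorem theorem1:
  fixes I :: "real set"
    and \<sigma> :: "real \<Rightarrow> 'o::metric_space \<Rightarrow> 'o"
    and P :: "real \<Rightarrow> 'o measure"
    and J :: "'s::banach \<Rightarrow> 'w::banach"
    and \<psi> :: "'w \<Rightarrow> 'k::real_normed_field"
    and L :: "'o \<Rightarrow> real \<Rightarrow> 'w \<Rightarrow> 'w"
    and \<Omega> :: "real \<Rightarrow> 'o set"
    and h :: "'o \<Rightarrow> real \<Rightarrow> 's"
    and C lam \<zeta> \<alpha> c :: real
  assumes "perturbed_operator_cocycle I \<sigma> P J \<psi> L"
    and "C > 0" and "lam > 0" and "0 < \<zeta>" and "\<zeta> \<le> 1"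
    and "\<And>\<epsilon>. \<epsilon> \<in> I \<Longrightarrow> \<Omega> \<epsilon> \<in> sets (P \<epsilon>)"
    and "\<And>\<epsilon>. \<epsilon> \<in> I \<Longrightarrow> \<sigma> \<epsilon> -` \<Omega> \<epsilon> = \<Omega> \<epsilon>"
    and "\<And>\<epsilon>. \<epsilon> \<in> I \<Longrightarrow> measure (P \<epsilon>) (\<Omega> \<epsilon>) = 1"
    and "\<And>f n \<epsilon> \<omega>. \<psi> f = 0 \<Longrightarrow> n \<ge> 1 \<Longrightarrow> \<epsilon> \<in> I \<Longrightarrow> \<omega> \<in> \<Omega> \<epsilon> \<Longrightarrow>
           norm (cocycle (\<sigma> \<epsilon>) (\<lambda>\<omega>'. L \<omega>' \<epsilon>) \<omega> n f) \<le> C * exp (- lam * real n) * norm f"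
    and "\<And>\<epsilon> g \<omega> \<omega>'. \<epsilon> \<in> I \<Longrightarrow> \<omega> \<in> \<Omega> \<epsilon> \<Longrightarrow> \<omega>' \<in> \<Omega> 0 \<Longrightarrow>
           norm (L \<omega> \<epsilon> (J g) - L \<omega>' 0 (J g))
             \<le> C * (dist \<omega> \<omega>' powr \<zeta> + \<bar>\<epsilon>\<bar> powr \<zeta>) * norm g"
    and "\<And>\<epsilon> \<omega>. \<epsilon> \<in> I \<Longrightarrow> \<omega> \<in> \<Omega> \<epsilon> \<Longrightarrow> \<psi> (J (h \<omega> \<epsilon>)) = 1 \<and> norm (h \<omega> \<epsilon>) \<le> C"
    and "\<And>\<epsilon> \<omega>. \<epsilon> \<in> I \<Longrightarrow> \<omega> \<in> \<Omega> \<epsilon> \<Longrightarrow> L \<omega> \<epsilon> (J (h \<omega> \<epsilon>)) = J (h (\<sigma> \<epsilon> \<omega>) \<epsilon>)"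
    and "\<exists>K. K-lipschitz_on UNIV (inv (\<sigma> 0))"
    and "c = ln (Lip (inv (\<sigma> 0)))"
    and "0 < \<alpha>" and "\<alpha> \<le> 1" and "c * \<alpha> * \<zeta> < lam"
  shows "\<exists>D>0. \<forall>\<epsilon>\<in>I. \<forall>\<omega>\<in>\<Omega> \<epsilon> \<inter> \<Omega> 0.
           norm (J (h \<omega> \<epsilon>) - J (h \<omega> 0))
             \<le> D * (\<bar>\<epsilon>\<bar> powr \<zeta> + dist_C0 (inv (\<sigma> 0)) (inv (\<sigma> \<epsilon>)) powr (\<alpha> * \<zeta>))"
proof -
  interpret perturbed_operator_cocycle I \<sigma> P J \<psi> L by fact
  note invariant = assms(7) and decay = assms(9) and L_close = assms(10)
    and h_bound = assms(11) and h_equivariant = assms(12)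
  interpret \<psi>: bounded_linear \<psi> by (rule bounded_linear_\<psi>)

  define \<beta> where "\<beta> = \<alpha> * \<zeta>"
  have \<beta>: "\<beta> > 0" using assms by (simp add: \<beta>_def)
  \<comment> \<open>The strict gap leaves room for \<open>t\<close>: above \<open>c\<close>, so that
    \<open>exp t\<close> exceeds the Lipschitz constant; above 0, so that \<open>exp t > 1\<close>;
    below \<open>lam / \<beta>\<close>, so that the series converges.\<close>
  have "max c 0 < lam / \<beta>"
    using assms \<beta> by (simp add: \<beta>_def pos_less_divide_eq mult.assoc)
  then obtain t where t: "max c 0 < t" "t < lam / \<beta>" using dense by blast
  then have t\<beta>: "t * \<beta> < lam" using \<beta> by (simp add: pos_less_divide_eq)
  define M where "M = exp t"
  have M: "M > 1" using t by (simp add: M_def)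
  have "Lip (inv (\<sigma> 0)) < M"
  proof (cases "Lip (inv (\<sigma> 0)) > 0")
    case True
    then have "Lip (inv (\<sigma> 0)) = exp c" using assms by simp
    then show ?thesis using t by (simp add: M_def)
  next
    \<comment> \<open>Now \<open>c\<close> is a logarithm at a non-positive argument and says
      nothing about \<open>Lip\<close>; \<open>M > 1\<close> suffices.\<close>
    case False
    then show ?thesis using M by linarith
  qed
  then have lip: "M-lipschitz_on UNIV (inv (\<sigma> 0))"
    using assms by (intro lipschitz_on_of_Lip_less)
  obtain B0 where B0: "\<And>u v :: 'o. dist u v \<le> B0"
    using bounded_space unfolding bounded_two_points by blast
  define B where "B = max B0 1"
  have B: "B \<ge> 1" "\<And>u v :: 'o. dist u v \<le> B"
    using B0 by (auto simp: B_def intro: max.coboundedI1)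
  \<comment> \<open>Ratio of the final series: per step, the bound on \<open>b\<close> grows by
    \<open>exp (t * \<beta>)\<close> and the cocycle contracts by
    \<open>exp (- lam)\<close>.\<close>
  define r where "r = exp (t * \<beta> - lam)"
  have r: "r > 0" "r < 1" using t\<beta> by (auto simp: r_def)
  \<comment> \<open>\<open>K\<close> collects the constants of the orbit estimate; being at least 1,
    it also serves for the term in \<epsilon>.\<close>
  define K where "K = max 1 (B * (M / (M - 1)) powr \<beta>)"
  define C1 where "C1 = max C 1"
  define D where "D = C1 * (C\<^sup>2 * K) / (1 - r)"
  have C1: "C1 \<ge> C" "C1 \<ge> 1" and K: "K \<ge> 1" "K \<ge> B * (M / (M - 1)) powr \<beta>"
    by (auto simp: C1_def K_def)
  have "D > 0" using C1 K r assms(2) by (auto simp: D_def intro!: divide_pos_pos mult_pos_pos)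
  \<comment> \<open>The decay hypothesis starts at \<open>n = 1\<close>. The summand
    \<open>j = 0\<close> needs \<open>n = 0\<close>, where the cocycle is \<open>id\<close> and
    \<open>C1 \<ge> 1\<close> is used.\<close>
  have decay': "norm (cocycle (\<sigma> 0) (\<lambda>\<omega>'. L \<omega>' 0) \<omega> n f) \<le> C1 * exp (- lam * real n) * norm f"
    if "\<psi> f = 0" "\<omega> \<in> \<Omega> 0" for \<omega> n f
  proof (cases "n = 0")
    case True
    then show ?thesis using C1 by (simp add: mult_le_cancel_right1)
  next
    case False
    then have "norm (cocycle (\<sigma> 0) (\<lambda>\<omega>'. L \<omega>' 0) \<omega> n f) \<le> C * exp (- lam * real n) * norm f"
      using that zero_in_I by (intro decay) auto
    also have "\<dots> \<le> C1 * exp (- lam * real n) * norm f"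
      using C1 by (intro mult_right_mono) auto
    finally show ?thesis .
  qed

  have "norm (J (h \<omega> \<epsilon>) - J (h \<omega> 0)) \<le> D * (\<bar>\<epsilon>\<bar> powr \<zeta> + dist_C0 (inv (\<sigma> 0)) (inv (\<sigma> \<epsilon>)) powr \<beta>)"
    if \<epsilon>: "\<epsilon> \<in> I" and \<omega>: "\<omega> \<in> \<Omega> \<epsilon>" "\<omega> \<in> \<Omega> 0" for \<epsilon> \<omega>
  proof -
    define \<delta> where "\<delta> = dist_C0 (inv (\<sigma> 0)) (inv (\<sigma> \<epsilon>))"
    define E where "E = \<bar>\<epsilon>\<bar> powr \<zeta> + \<delta> powr \<beta>"
    have close: "dist (inv (\<sigma> 0) y) (inv (\<sigma> \<epsilon>) y) \<le> \<delta>" for y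
      unfolding \<delta>_def by (rule dist_le_dist_C0[OF bounded_space])
    have \<delta>: "\<delta> \<ge> 0" using close zero_le_dist order_trans by blast
    have right_inv: "\<sigma> e (inv (\<sigma> e) y) = y" if "e \<in> I" for e y
      using homeomorphism_\<sigma>[OF that] by (simp add: homeomorphism_def)
    define q where "q e j = (inv (\<sigma> e) ^^ j) \<omega>" for e j
    have q_step: "\<sigma> e (q e (Suc j)) = q e j" if "e \<in> I" for e j
      using right_inv[OF that] by (simp add: q_def)
    \<comment> \<open>Invariance as an equality with the full preimage lets membership pass backward
      along the orbit.\<close>
    have q_mem: "q e j \<in> \<Omega> e" if "e \<in> I" "\<omega> \<in> \<Omega> e" for e j
    proof (induction j)
      case 0
      then show ?case using that by (simp add: q_def)
    next
      case (Suc j)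
      then have "q e (Suc j) \<in> \<sigma> e -` \<Omega> e" using q_step[OF that(1)] by simp
      then show ?case using invariant[OF that(1)] by simp
    qed
    define x y where "x = q \<epsilon>" and "y = q 0"
    have x: "x j \<in> \<Omega> \<epsilon>" "\<sigma> \<epsilon> (x (Suc j)) = x j" and y: "y j \<in> \<Omega> 0" "\<sigma> 0 (y (Suc j)) = y j" for j
      using q_mem q_step \<epsilon> \<omega> zero_in_I by (auto simp: x_def y_def)
    define a where "a j = J (h (x j) \<epsilon>) - J (h (y j) 0)" for j
    \<comment> \<open>Both operators act on the same strong vector, so their closeness applies; the
      rest of \<open>a j\<close> is the unperturbed operator applied to
      \<open>a (Suc j)\<close>.\<close>
    define b where
      "b j = L (x (Suc j)) \<epsilon> (J (h (x (Suc j)) \<epsilon>)) - L (y (Suc j)) 0 (J (h (x (Suc j)) \<epsilon>))" for j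
    have lin: "linear (L z 0)" for z
      using bounded_linear_L[OF zero_in_I] by (rule bounded_linear.linear)
    have a_step: "a j = b j + L (y (Suc j)) 0 (a (Suc j))" for j
      using h_equivariant[OF \<epsilon> x(1)[of "Suc j"]] h_equivariant[OF zero_in_I y(1)[of "Suc j"]]
      by (simp add: a_def b_def x y linear_diff[OF lin])
    have \<psi>a: "\<psi> (a j) = 0" for j
      using h_bound[OF \<epsilon> x(1)] h_bound[OF zero_in_I y(1)] by (simp add: a_def \<psi>.diff)
    have \<psi>b: "\<psi> (b j) = 0" for j
      by (simp add: b_def \<psi>.diff \<psi>_L \<epsilon> zero_in_I)
    have norm_a: "norm (a j) \<le> 2 * C" for j
    proof -
      have "norm (a j) \<le> norm (J (h (x j) \<epsilon>)) + norm (J (h (y j) 0))"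
        unfolding a_def by (rule norm_triangle_ineq4)
      also have "\<dots> \<le> norm (h (x j) \<epsilon>) + norm (h (y j) 0)" by (intro add_mono norm_J_le)
      also have "\<dots> \<le> 2 * C" using h_bound[OF \<epsilon> x(1)[of j]] h_bound[OF zero_in_I y(1)[of j]] by simp
      finally show ?thesis .
    qed
    have dist_xy: "dist (x (Suc j)) (y (Suc j)) powr \<zeta> \<le> K * \<delta> powr \<beta> * exp (t * \<beta>) ^ j" for j
    proof -
      let ?d = "dist (x (Suc j)) (y (Suc j))"
      have "?d powr \<zeta> \<le> B * ?d powr \<beta>"
        unfolding \<beta>_def using assms B by (intro powr_le_mult_powr) auto
      also have "?d \<le> \<delta> * M ^ Suc j / (M - 1)"
        using dist_funpow_le[OF lip M close, of "Suc j" \<omega>]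
        by (simp add: x_def y_def q_def dist_commute)
      then have "?d powr \<beta> \<le> (\<delta> * M ^ Suc j / (M - 1)) powr \<beta>"
        using \<beta> by (intro powr_mono2) auto
      \<comment> \<open>The operators act at index \<open>Suc j\<close>; the extra factor
        \<open>M\<close> goes into the constant, leaving growth \<open>M ^ j\<close>.\<close>
      also have "\<delta> * M ^ Suc j / (M - 1) = \<delta> * (M / (M - 1)) * M ^ j" by simp
      also have "\<dots> powr \<beta> = \<delta> powr \<beta> * (M / (M - 1)) powr \<beta> * (M ^ j) powr \<beta>"
        by (simp only: powr_mult)
      also have "(M ^ j) powr \<beta> = exp (t * \<beta>) ^ j"
        by (simp add: M_def powr_def exp_of_nat_mult[symmetric] ln_realpow mult_ac)
      finally have "?d powr \<zeta> \<le> (B * (M / (M - 1)) powr \<beta>) * (\<delta> powr \<beta> * exp (t * \<beta>) ^ j)"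
        using B by (simp add: mult_ac)
      also have "\<dots> \<le> K * (\<delta> powr \<beta> * exp (t * \<beta>) ^ j)" using K by (intro mult_right_mono) auto
      finally show ?thesis by (simp add: mult.assoc)
    qed
    have norm_b: "norm (b j) \<le> C\<^sup>2 * K * E * exp (t * \<beta>) ^ j" for j
    proof -
      let ?d = "dist (x (Suc j)) (y (Suc j))"
      have "norm (b j) \<le> C * (?d powr \<zeta> + \<bar>\<epsilon>\<bar> powr \<zeta>) * norm (h (x (Suc j)) \<epsilon>)"
        unfolding b_def by (rule L_close[OF \<epsilon> x(1) y(1)])
      also have "\<dots> \<le> C * (?d powr \<zeta> + \<bar>\<epsilon>\<bar> powr \<zeta>) * C"
        using h_bound[OF \<epsilon> x(1)] assms(2) by (intro mult_left_mono) auto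
      also have "\<dots> = C\<^sup>2 * (?d powr \<zeta> + \<bar>\<epsilon>\<bar> powr \<zeta>)" by (simp add: power2_eq_square)
      \<comment> \<open>The term is inflated by a factor at least 1, so that both terms share a
        common factor and combine to \<open>E\<close>.\<close>
      also have "\<bar>\<epsilon>\<bar> powr \<zeta> \<le> K * \<bar>\<epsilon>\<bar> powr \<zeta> * exp (t * \<beta>) ^ j"
      proof -
        have "1 \<le> exp (t * \<beta>) ^ j" using t \<beta> by (intro one_le_power) simp
        then have "1 * 1 \<le> K * exp (t * \<beta>) ^ j" using K by (intro mult_mono) auto
        then have "\<bar>\<epsilon>\<bar> powr \<zeta> * 1 \<le> \<bar>\<epsilon>\<bar> powr \<zeta> * (K * exp (t * \<beta>) ^ j)"
          by (intro mult_left_mono) auto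
        then show ?thesis by (simp add: mult_ac)
      qed
      then have "C\<^sup>2 * (?d powr \<zeta> + \<bar>\<epsilon>\<bar> powr \<zeta>)
          \<le> C\<^sup>2 * (K * \<delta> powr \<beta> * exp (t * \<beta>) ^ j + K * \<bar>\<epsilon>\<bar> powr \<zeta> * exp (t * \<beta>) ^ j)"
        using dist_xy by (intro mult_left_mono add_mono) auto
      also have "\<dots> = C\<^sup>2 * K * E * exp (t * \<beta>) ^ j" by (simp add: E_def algebra_simps)
      finally show ?thesis .
    qed
    let ?A = "cocycle (\<sigma> 0) (\<lambda>z. L z 0)"
    have norm_a0: "norm (a 0) \<le> D * E + C1 * exp (- lam) ^ n * (2 * C)" for n
    proof -
      have "norm (?A (y j) j (b j)) \<le> C1 * (C\<^sup>2 * K) * E * r ^ j" for j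
      proof -
        have "norm (?A (y j) j (b j)) \<le> C1 * exp (- lam * real j) * norm (b j)"
          by (rule decay'[OF \<psi>b y(1)])
        also have "\<dots> \<le> C1 * exp (- lam * real j) * (C\<^sup>2 * K * E * exp (t * \<beta>) ^ j)"
          using C1 by (intro mult_left_mono norm_b) auto
        also have "exp (- lam * real j) = exp (- lam) ^ j"
          by (simp add: exp_of_nat_mult[symmetric] mult.commute)
        also have "C1 * exp (- lam) ^ j * (C\<^sup>2 * K * E * exp (t * \<beta>) ^ j)
            = C1 * (C\<^sup>2 * K) * E * (exp (t * \<beta>) * exp (- lam)) ^ j"
          by (simp add: power_mult_distrib mult_ac)
        also have "exp (t * \<beta>) * exp (- lam) = r" by (simp add: r_def exp_add[symmetric])
        finally show ?thesis .
      qed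
      then have "norm (\<Sum>j<n. ?A (y j) j (b j)) \<le> (\<Sum>j<n. C1 * (C\<^sup>2 * K) * E * r ^ j)"
        by (intro sum_norm_le) auto
      also have "\<dots> = C1 * (C\<^sup>2 * K) * E * (\<Sum>j<n. r ^ j)" by (simp add: sum_distrib_left)
      also have "\<dots> \<le> C1 * (C\<^sup>2 * K) * E * (1 / (1 - r))"
        using r C1 K by (intro mult_left_mono sum_power_le) (auto simp: E_def)
      also have "\<dots> = D * E" by (simp add: D_def)
      finally have sum: "norm (\<Sum>j<n. ?A (y j) j (b j)) \<le> D * E" .
      have "norm (?A (y n) n (a n)) \<le> C1 * exp (- lam * real n) * norm (a n)"
        by (rule decay'[OF \<psi>a y(1)])
      also have "\<dots> \<le> C1 * exp (- lam * real n) * (2 * C)"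
        using C1 by (intro mult_left_mono norm_a) auto
      also have "exp (- lam * real n) = exp (- lam) ^ n"
        by (simp add: exp_of_nat_mult[symmetric] mult.commute)
      finally have tail: "norm (?A (y n) n (a n)) \<le> C1 * exp (- lam) ^ n * (2 * C)" .
      have "a 0 = (\<Sum>j<n. ?A (y j) j (b j)) + ?A (y n) n (a n)"
        by (rule cocycle_telescope) (fact lin y(2) a_step)+
      then show ?thesis using norm_triangle_le[OF add_mono[OF sum tail]] by simp
    qed
    \<comment> \<open>The number \<open>n\<close> of backward steps is free and \<open>D\<close>
      does not depend on it, so the tail vanishes in the limit.\<close>
    have "(\<lambda>n. D * E + C1 * exp (- lam) ^ n * (2 * C)) \<longlonglongrightarrow> D * E + C1 * 0 * (2 * C)"
      using assms(3) by (intro tendsto_intros LIMSEQ_power_zero) simp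
    then have "norm (a 0) \<le> D * E + C1 * 0 * (2 * C)"
      by (rule LIMSEQ_le_const) (use norm_a0 in blast)
    then show ?thesis by (simp add: a_def x_def y_def q_def E_def \<delta>_def)
  qed
  then show ?thesis using \<open>D > 0\<close> unfolding \<beta>_def by blast
qed

end
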